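(* Let $p$ be an odd prime and $R\in\mathbb{Z}$ with $R\neq0,\pm1$, and let $r\in\mathbb{F}_p$ be the residue class of $R$; assume $r\notin\{0,1,-1\}$. Let $z=-r-2-r^{-1}\in\mathbb{F}_p$. Then $\gamma_z(X)=X^{p+1}+(z+1)X^p+X+1\in\mathbb{F}_p[X]$ has exactly two linear factors, and all its other irreducible factors have the same degree $m$, where $m$ is the multiplicative order of $r$ in $\mathbb{F}_p^*$. In particular, $R$ is a primitive root mod $p$ if and only if $\gamma_z(X)/(X^2+(z+2)X+1)$ is irreducible in $\mathbb{F}_p[X]$.
   Context: A primitive root mod $p$ is an integer whose residue class generates the cyclic group $\mathbb{F}_p^*$. *)

theory Defs
  imports
    "Berlekamp_Zassenhaus.Finite_Field"
    "HOL-Algebra.Generated_Groups"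
    "HOL-Algebra.Multiplicative_Group"
    "HOL-Computational_Algebra.Polynomial_Factorial"
begin

hide_const (open) Multiset.mult

text \<open>
  For a prime \<open>p = CARD('p)\<close>, the field with \<open>p\<close> elements is the type \<open>'p mod_ring\<close>, and the residue
  class of an integer \<open>R\<close> is \<open>of_int R :: 'p mod_ring\<close>.
\<close>

definition Fp_units :: "'p::prime_card mod_ring monoid" where
  "Fp_units = \<lparr>carrier = UNIV - {0}, mult = (*), one = 1\<rparr>"

lemma group_Fp_units: "group (Fp_units :: 'p::prime_card mod_ring monoid)"
proof (rule groupI)
  fix x :: "'p mod_ring"
  assume "x \<in> carrier Fp_units"
  then have "inverse x \<in> carrier Fp_units" "inverse x \<otimes>\<^bsub>Fp_units\<^esub> x = \<one>\<^bsub>Fp_units\<^esub>"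
    by (auto simp: Fp_units_def)
  then show "\<exists>y\<in>carrier Fp_units. y \<otimes>\<^bsub>Fp_units\<^esub> x = \<one>\<^bsub>Fp_units\<^esub>" ..
qed (auto simp: Fp_units_def mult.assoc)

text \<open>
  The membership conjunct is needed because \<open>generate\<close> is only meaningful for subsets of the
  carrier.
\<close>

definition primitive_root_mod :: "'p::prime_card itself \<Rightarrow> int \<Rightarrow> bool" where
  "primitive_root_mod _ R \<longleftrightarrow>
     (of_int R :: 'p mod_ring) \<in> carrier Fp_units \<and>
     generate Fp_units {of_int R :: 'p mod_ring} = carrier Fp_units"

definition gamma_poly :: "'p::prime_card mod_ring \<Rightarrow> 'p mod_ring poly" where
  "gamma_poly z = monom 1 (CARD('p) + 1) + monom (z + 1) CARD('p) + monom 1 1 + 1"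

end

theory Submission
  imports Defs "Berlekamp_Zassenhaus.Distinct_Degree_Factorization" "HOL-Number_Theory.Cong"
begin

text \<open>
  The roots of \<open>\<gamma>\<^sub>z\<close> satisfy \<open>X\<^sup>p = - (X + 1) / (X + z + 1)\<close>, a Moebius transformation with
  fixed points \<open>r\<close> and \<open>s = 1 / r\<close> and multiplier \<open>r\<close>. In the coordinate \<open>Y = (X - r) / (X - s)\<close>
  the equation is \<open>Y\<^sup>p = r Y\<close>, so that Frobenius acts on the roots other than \<open>r\<close> and \<open>s\<close> as
  multiplication by \<open>r\<close>, and every orbit has the order of \<open>r\<close> as its length. Without leaving the
  polynomial ring this reads \<open>(1 - r) \<gamma>\<^sub>z = A B (A\<^sup>p\<^sup>-\<^sup>1 - r B\<^sup>p\<^sup>-\<^sup>1)\<close> for \<open>A = X - r\<close> and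
  \<open>B = X - s\<close>, where a factor of the last term divides \<open>X ^ (p ^ k) - X\<close> iff \<open>r ^ k = 1\<close>.
\<close>

section \<open>Powers of Frobenius modulo an irreducible polynomial\<close>

lemma linear_power_card_power:
  fixes a :: "'p::prime_card mod_ring"
  shows "[:- a, 1:] ^ (CARD('p) ^ k) = monom 1 1 ^ (CARD('p) ^ k) - [:a:]"
proof -
  have "[:- a, 1:] = monom 1 1 + [:- a:]"
    by (simp add: monom_altdef)
  then show ?thesis
    by (simp only: add_power_prime_poly_mod_ring fermat_theorem_power_poly) simp
qed

text \<open>Since \<open>p^(k+1) - 1 = (p^k - 1) * p + (p - 1)\<close>, the \<open>p\<close>-th
  power of case \<open>k\<close> times the hypothesis gives the next case; Frobenius fixes the
  constant \<open>r ^ k\<close>.\<close>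

lemma cong_power_card_power:
  fixes A B q :: "'p::prime_card mod_ring poly"
  assumes "[A ^ (CARD('p) - 1) = [:r:] * B ^ (CARD('p) - 1)] (mod q)"
  shows "[A ^ (CARD('p) ^ k - 1) = [:r ^ k:] * B ^ (CARD('p) ^ k - 1)] (mod q)"
proof (induction k)
  case 0
  then show ?case by (simp add: cong_def)
next
  case (Suc k)
  let ?p = "CARD('p)"
  have p: "?p > 0" by simp
  have exp: "?p ^ Suc k - 1 = (?p ^ k - 1) * ?p + (?p - 1)"
    using p by (cases "?p ^ k") (simp_all add: algebra_simps)
  have r: "[:r ^ k:] ^ ?p = [:r ^ k:]"
    using fermat_theorem_power_poly[of "r ^ k" 1] by simp
  have "[(A ^ (?p ^ k - 1)) ^ ?p * A ^ (?p - 1)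
      = ([:r ^ k:] * B ^ (?p ^ k - 1)) ^ ?p * ([:r:] * B ^ (?p - 1))] (mod q)"
    by (intro cong_mult cong_pow Suc.IH assms)
  also have "([:r ^ k:] * B ^ (?p ^ k - 1)) ^ ?p * ([:r:] * B ^ (?p - 1))
      = ([:r ^ k:] * [:r:]) * ((B ^ (?p ^ k - 1)) ^ ?p * B ^ (?p - 1))"
    by (simp only: power_mult_distrib r mult_ac)
  also have "[:r ^ k:] * [:r:] = [:r ^ Suc k:]" by simp
  finally show ?case
    by (simp only: exp power_add power_mult)
qed

lemma irreducible_not_dvd_const:
  fixes q :: "'a :: field poly"
  assumes "irreducible q" "c \<noteq> 0"
  shows "\<not> q dvd [:c:]"
  using assms by (meson dvd_trans irreducible_not_unit is_unit_const_poly_iff dvd_field_iff)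

text \<open>With \<open>n = p^k\<close>, the product \<open>(r - s) * (X^n - X)\<close> equals
  \<open>A * B * (A^(n-1) - B^(n-1))\<close>, whose last factor is
  \<open>(r^k - 1) * B^(n-1)\<close> modulo \<open>q\<close>. As \<open>q\<close> divides neither
  \<open>A\<close> nor \<open>B\<close>, the constant \<open>r^k - 1\<close> decides.\<close>

lemma irreducible_dvd_frobenius_iff:
  fixes r s :: "'p::prime_card mod_ring"
  assumes q: "irreducible q" and "r \<noteq> s"
    and dvd: "q dvd [:- r, 1:] ^ (CARD('p) - 1) - [:r:] * [:- s, 1:] ^ (CARD('p) - 1)"
    and A: "\<not> q dvd [:- r, 1:]" and B: "\<not> q dvd [:- s, 1:]"
  shows "q dvd monom 1 1 ^ (CARD('p) ^ k) - monom 1 1 \<longleftrightarrow> r ^ k = 1"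
proof -
  let ?A = "[:- r, 1:]" and ?B = "[:- s, 1:]" and ?X = "monom 1 1 :: 'p mod_ring poly"
  let ?n = "CARD('p) ^ k"
  have n: "?n = Suc (?n - 1)" by simp
  have prime: "prime_elem q" using q by (rule irreducible_imp_prime_elem)
  note unit = irreducible_not_dvd_const[OF q]
  have cong: "[?A ^ (?n - 1) = [:r ^ k:] * ?B ^ (?n - 1)] (mod q)"
    by (rule cong_power_card_power) (use dvd in \<open>simp add: cong_iff_dvd_diff\<close>)
  \<comment> \<open>Here \<open>A^n = X^n - r\<close> and \<open>B^n = X^n - s\<close>, so the terms
    \<open>X^(n+1)\<close> and \<open>r * s\<close> cancel on the right.\<close>
  have "[:r - s:] * (?X ^ ?n - ?X) = ?A ^ ?n * ?B - ?B ^ ?n * ?A"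
    by (simp only: linear_power_card_power)
      (simp add: algebra_simps monom_altdef smult_diff_left)
  also have "\<dots> = ?A * ?B * (?A ^ (?n - 1) - ?B ^ (?n - 1))"
    by (subst (1 2) n) (simp only: power_Suc algebra_simps)
  finally have eq: "[:r - s:] * (?X ^ ?n - ?X) = ?A * ?B * (?A ^ (?n - 1) - ?B ^ (?n - 1))" .
  have "q dvd ?X ^ ?n - ?X \<longleftrightarrow> q dvd [:r - s:] * (?X ^ ?n - ?X)"
    using prime unit \<open>r \<noteq> s\<close> by (simp only: prime_elem_dvd_mult_iff) simp
  also have "\<dots> \<longleftrightarrow> q dvd ?A ^ (?n - 1) - ?B ^ (?n - 1)"
    using prime A B by (simp only: eq prime_elem_dvd_mult_iff) simp
  also have "\<dots> \<longleftrightarrow> q dvd [:r ^ k:] * ?B ^ (?n - 1) - ?B ^ (?n - 1)"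
    unfolding cong_iff_dvd_diff[symmetric] using cong cong_trans cong_sym by blast
  also have "[:r ^ k:] * ?B ^ (?n - 1) - ?B ^ (?n - 1) = [:r ^ k - 1:] * ?B ^ (?n - 1)"
    by (simp add: algebra_simps smult_diff_left)
  also have "q dvd \<dots> \<longleftrightarrow> q dvd [:r ^ k - 1:]"
    using prime B prime_elem_dvd_power by (metis prime_elem_dvd_mult_iff)
  also have "\<dots> \<longleftrightarrow> r ^ k = 1"
    using unit[of "r ^ k - 1"] by auto
  finally show ?thesis .
qed

section \<open>Orders in the unit group and degrees of factors\<close>

lemma Fp_units_pow: "x [^]\<^bsub>Fp_units\<^esub> (n::nat) = x ^ n"
  by (induction n) (simp_all add: Fp_units_def nat_pow_def mult.commute)

lemma finite_Fp_units: "finite (carrier Fp_units)"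
  by (simp add: Fp_units_def)

lemma card_Fp_units: "card (carrier (Fp_units :: 'p::prime_card mod_ring monoid)) = CARD('p) - 1"
  by (simp add: Fp_units_def card_Diff_singleton)

lemma ord_Fp_units_eqI:
  fixes r :: "'p::prime_card mod_ring"
  assumes "r \<noteq> 0" "r ^ n = 1" "n \<noteq> 0" "\<And>k. 1 \<le> k \<Longrightarrow> k < n \<Longrightarrow> r ^ k \<noteq> 1"
  shows "group.ord Fp_units r = n"
proof -
  interpret group "Fp_units :: 'p mod_ring monoid" by (rule group_Fp_units)
  have r: "r \<in> carrier Fp_units" using \<open>r \<noteq> 0\<close> by (simp add: Fp_units_def)
  have one: "\<one>\<^bsub>Fp_units\<^esub> = (1 :: 'p mod_ring)" by (simp add: Fp_units_def)
  have "ord r dvd n" using pow_eq_id[OF r] assms by (simp add: Fp_units_pow one)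
  moreover have "r ^ ord r = 1"
    using pow_ord_eq_1[OF r] by (simp add: Fp_units_pow one)
  ultimately show ?thesis
    using assms(3) assms(4)[of "ord r"] dvd_imp_le[of "ord r" n] dvd_0_left_iff[of n]
    by (cases "ord r = 0") (auto simp: Suc_le_eq intro: le_neq_implies_less)
qed

text \<open>The degree of \<open>q\<close> is the least \<open>k > 0\<close> such that
  \<open>q\<close> divides \<open>X^(p^k) - X\<close>, which by the Frobenius criterion is the least
  \<open>k > 0\<close> with \<open>r ^ k = 1\<close>.\<close>

lemma degree_eq_ord:
  fixes r s :: "'p::prime_card mod_ring"
  assumes "irreducible q" "r \<noteq> 0" "r \<noteq> s"
    and dvd: "q dvd [:- r, 1:] ^ (CARD('p) - 1) - [:r:] * [:- s, 1:] ^ (CARD('p) - 1)"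
  shows "degree q = group.ord Fp_units r"
proof -
  let ?A = "[:- r, 1:]" and ?B = "[:- s, 1:]" and ?n = "CARD('p) - 1"
  have prime: "prime_elem q" using assms(1) by (rule irreducible_imp_prime_elem)
  have n: "?n \<noteq> 0" using prime_gt_1_nat[OF prime_card[where 'a = 'p]] by simp
  note unit = irreducible_not_dvd_const[OF assms(1)]
  \<comment> \<open>The difference \<open>A - B\<close> is the nonzero constant
    \<open>s - r\<close>.\<close>
  have not_both: "\<not> (q dvd ?A \<and> q dvd ?B)"
    using unit[of "s - r"] dvd_diff[of q "[:- r, 1:]" "[:- s, 1:]"] \<open>r \<noteq> s\<close> by auto
  \<comment> \<open>As \<open>r\<close> is nonzero, dividing one of \<open>A\<close>,
    \<open>B\<close> would entail dividing the other; hence \<open>q\<close> divides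
    neither.\<close>
  have iff: "q dvd ?A ^ ?n \<longleftrightarrow> q dvd [:r:] * ?B ^ ?n"
    using dvd by (metis diff_add_cancel dvd_add_right_iff)
  then have "q dvd ?A \<longleftrightarrow> q dvd ?B"
    using prime n unit[OF \<open>r \<noteq> 0\<close>]
    by (simp only: prime_elem_dvd_mult_iff prime_elem_dvd_power_iff) simp
  with not_both have AB: "\<not> q dvd ?A" "\<not> q dvd ?B" by auto
  note frob = irreducible_dvd_frobenius_iff[OF assms(1,3) dvd AB]
  have "degree q \<noteq> 0"
    using irreducible_degree_field[OF assms(1)] by simp
  then have "group.ord Fp_units r = degree q"
    using degree_divisor[OF assms(1) refl] frob assms(2) by (intro ord_Fp_units_eqI) auto
  then show ?thesis ..
qed

section \<open>The factorization of the polynomial\<close>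

definition cofactor :: "'p::prime_card mod_ring \<Rightarrow> 'p mod_ring poly" where
  "cofactor r = [:inverse (1 - r):] *
     ([:- r, 1:] ^ (CARD('p) - 1) - [:r:] * [:- inverse r, 1:] ^ (CARD('p) - 1))"

text \<open>Multiplication by \<open>A * B\<close> turns the \<open>(p-1)\<close>-th powers into
  \<open>p\<close>-th powers. Inserting \<open>A^p = X^p - r\<close> and
  \<open>B^p = X^p - 1/r\<close> leaves four terms, with common factor \<open>1 - r\<close>.\<close>

lemma gamma_poly_factorization:
  fixes r :: "'p::prime_card mod_ring"
  assumes "r \<noteq> 0" "r \<noteq> 1"
  shows "gamma_poly (- r - 2 - inverse r) = [:- r, 1:] * [:- inverse r, 1:] * cofactor r"
proof -
  let ?p = "CARD('p)" and ?s = "inverse r"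
  let ?A = "[:- r, 1:]" and ?B = "[:- ?s, 1:]"
  have p: "?p = Suc (?p - 1)" by simp
  have s: "r * ?s = 1" using assms by simp
  have pow: "[:- a, 1:] ^ ?p = monom 1 ?p - [:a:]" for a :: "'p mod_ring"
    using linear_power_card_power[of a 1] by (simp add: monom_power)
  have X: "monom a (Suc n) = [:0, 1:] * monom a n" for a :: "'p mod_ring" and n
    by (simp add: monom_Suc)
  have const: "1 + [:- r:] = [:1 - r:]"
    by (simp only: one_pCons add_pCons) simp
  \<comment> \<open>This prepares the coefficient of \<open>X^p\<close>. For a free \<open>t\<close>
    it is a pure ring identity; \<open>r * t = 1\<close> enters only when \<open>t\<close> becomes
    the inverse of \<open>r\<close>.\<close>
  have "(1 - r) * (- r - 2 - t + 1) = r * r - t + (r * t - 1)" for t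
    by (simp add: algebra_simps)
  from this[of ?s] have mid: "(1 - r) * (- r - 2 - ?s + 1) = r * r - ?s"
    by (simp only: s) simp
  have "?A * ?B * (?A ^ (?p - 1) - [:r:] * ?B ^ (?p - 1)) = ?A ^ ?p * ?B - [:r:] * (?B ^ ?p * ?A)"
    by (subst (3 4) p) (simp only: power_Suc algebra_simps)
  also have "\<dots> = (monom 1 ?p - [:r:]) * ?B - [:r:] * ((monom 1 ?p - [:?s:]) * ?A)"
    by (simp only: pow)
  also have "\<dots> = [:1 - r:] * monom 1 (?p + 1) + [:r * r - ?s:] * monom 1 ?p
      + [:1 - r:] * monom 1 1 + [:1 - r:]"
    using s by (simp add: X const monom_0 algebra_simps smult_diff_left smult_add_left)
  also have "\<dots> = [:1 - r:] * gamma_poly (- r - 2 - ?s)"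
    unfolding mid[symmetric] gamma_poly_def
    by (simp add: algebra_simps smult_monom const)
  finally have "[:inverse (1 - r):] * ([:1 - r:] * gamma_poly (- r - 2 - ?s)) = ?A * ?B * cofactor r"
    unfolding cofactor_def by (simp only: mult_ac)
  then show ?thesis using assms by simp
qed

lemma degree_gamma_poly: "degree (gamma_poly (z :: 'p::prime_card mod_ring)) = CARD('p) + 1"
proof (rule antisym)
  have p: "CARD('p) > 1" using prime_gt_1_nat[OF prime_card] .
  show "degree (gamma_poly z) \<le> CARD('p) + 1"
    by (rule degree_le) (auto simp: gamma_poly_def)
  show "CARD('p) + 1 \<le> degree (gamma_poly z)"
    by (rule le_degree) (use p in \<open>auto simp: gamma_poly_def\<close>)
qed

text \<open>Besides being a prime element, \<open>prime\<close> demands normalization, which the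
  leading coefficient 1 provides; so such factors occur literally in
  \<open>prime_factorization\<close>.\<close>

lemma prime_linear_poly: "prime [:a, 1 :: 'a :: field_gcd:]"
proof -
  have "prime_elem [:a, 1:]" by (rule prime_elem_linear_field_poly) simp
  moreover have "normalize [:a, 1:] = [:a, 1:]" by (rule normalize_monic) simp
  ultimately show ?thesis by (rule normalization_semidom_class.primeI)
qed

text \<open>The subgroup generated by a unit has as many elements as the order of the unit, and in a
  finite group a subset of full cardinality is everything. For residue 0 both sides are
  false.\<close>

lemma primitive_root_mod_iff_ord:
  "primitive_root_mod TYPE('p::prime_card) R \<longleftrightarrow>
     (of_int R :: 'p mod_ring) \<noteq> 0 \<and> group.ord Fp_units (of_int R :: 'p mod_ring) = CARD('p) - 1"
proof (cases "(of_int R :: 'p mod_ring) = 0")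
  case True
  then show ?thesis by (simp add: primitive_root_mod_def Fp_units_def)
next
  case False
  interpret group "Fp_units :: 'p mod_ring monoid" by (rule group_Fp_units)
  have R: "(of_int R :: 'p mod_ring) \<in> carrier Fp_units"
    using False by (simp add: Fp_units_def)
  have sub: "generate Fp_units {of_int R :: 'p mod_ring} \<subseteq> carrier Fp_units"
    using R generate_incl by simp
  have "generate Fp_units {of_int R :: 'p mod_ring} = carrier Fp_units \<longleftrightarrow>
      card (generate Fp_units {of_int R :: 'p mod_ring}) = card (carrier (Fp_units :: 'p mod_ring monoid))"
    using card_subset_eq[OF finite_Fp_units sub] by metis
  then show ?thesis
    using False R by (simp only: primitive_root_mod_def generate_pow_card[OF R] card_Fp_units) simp
qed

theorem theorem9p10:
  fixes p m :: nat and R :: int and r z :: "'p::prime_card mod_ring"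
  assumes p_card: "p = CARD('p)"
    and p_prime: "prime p"
    and p_odd: "odd p"
    and R: "R \<noteq> 0" "R \<noteq> 1" "R \<noteq> -1"
    and r_def: "r = of_int R"
    and r: "r \<notin> {0, 1, -1}"
    and z_def: "z = - r - 2 - inverse r"
    and m_def: "m = group.ord Fp_units r"
  shows "size {#q \<in># prime_factorization (gamma_poly z). degree q = 1#} = 2
    \<and> card {q. monic q \<and> degree q = 1 \<and> q dvd gamma_poly z} = 2
    \<and> (\<forall>q. irreducible q \<and> q dvd gamma_poly z \<and> degree q \<noteq> 1 \<longrightarrow> degree q = m)
    \<and> [:1, z + 2, 1:] dvd gamma_poly z
    \<and> (primitive_root_mod TYPE('p) R \<longleftrightarrow>
         irreducible (gamma_poly z div [:1, z + 2, 1:]))"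
proof -
  let ?A = "[:- r, 1:]" and ?B = "[:- inverse r, 1:]" and ?G = "cofactor r"
  interpret group "Fp_units :: 'p mod_ring monoid" by (rule group_Fp_units)
  have r0: "r \<noteq> 0" and r1: "r \<noteq> 1" and "r \<noteq> - 1" using r by auto
  have rs: "r \<noteq> inverse r"
  proof
    assume "r = inverse r"
    then have "r * r = 1" using r0 by (metis right_inverse)
    then have "(r - 1) * (r + 1) = 0" by (simp add: algebra_simps)
    then show False using r1 \<open>r \<noteq> - 1\<close> by (simp add: eq_neg_iff_add_eq_0)
  qed
  \<comment> \<open>This separates the factors of degree \<open>m\<close> from the linear
    ones.\<close>
  have m1: "m \<noteq> 1"
    using ord_eq_1[of r] r0 r1 by (simp add: m_def Fp_units_def)
  have factorization: "gamma_poly z = ?A * ?B * ?G"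
    unfolding z_def using r0 r1 by (rule gamma_poly_factorization)
  \<comment> \<open>The sum of \<open>r\<close> and its inverse is \<open>-(z + 2)\<close>, their
    product 1.\<close>
  have quadratic: "?A * ?B = [:1, z + 2, 1:]"
    using r0 by (simp add: z_def)
  have "gamma_poly z \<noteq> 0" using degree_gamma_poly[of z] by auto
  then have G0: "?G \<noteq> 0" using factorization by auto
  have degree_G: "degree ?G = p - 1"
    using degree_gamma_poly[of z] G0 unfolding factorization p_card
    by (simp add: degree_mult_eq del: mult_pCons_left mult_pCons_right)
  have degree_factor: "degree q = m" if "irreducible q" "q dvd ?G" for q
    unfolding m_def
  proof (rule degree_eq_ord[OF that(1) r0 rs])
    show "q dvd ?A ^ (CARD('p) - 1) - [:r:] * ?B ^ (CARD('p) - 1)"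
      using that(2) r1 unfolding cofactor_def by (simp add: dvd_smult_iff)
  qed
  have dvd_cases: "q dvd ?A \<or> q dvd ?B \<or> q dvd ?G" if "irreducible q" "q dvd gamma_poly z" for q
    using that(2) unfolding factorization
    by (simp only: prime_elem_dvd_mult_iff[OF irreducible_imp_prime_elem[OF that(1)]] disj_assoc)
  have "prime_factorization (gamma_poly z) = {#?A, ?B#} + prime_factorization ?G"
    unfolding factorization using G0
    by (simp add: prime_factorization_mult prime_factorization_prime prime_linear_poly
      del: mult_pCons_left mult_pCons_right pCons_one)
  moreover have "degree q \<noteq> 1" if "q \<in># prime_factorization ?G" for q
  proof -
    have "irreducible q"
      using that in_prime_factors_imp_prime prime_imp_prime_elem prime_elem_imp_irreducible by blast
    then show ?thesis using degree_factor in_prime_factors_imp_dvd[OF that] m1 by simp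
  qed
  then have "{#q \<in># prime_factorization ?G. degree q = 1#} = {#}"
    by (simp only: filter_mset_eq_mempty_iff) blast
  ultimately have size: "size {#q \<in># prime_factorization (gamma_poly z). degree q = 1#} = 2"
    by simp
  \<comment> \<open>The count above includes multiplicities; this one concerns distinct factors and
    yields two because \<open>r\<close> differs from its inverse.\<close>
  have "{q. monic q \<and> degree q = 1 \<and> q dvd gamma_poly z} = {?A, ?B}"
  proof (intro equalityI subsetI)
    fix q assume "q \<in> {q. monic q \<and> degree q = 1 \<and> q dvd gamma_poly z}"
    then have q: "monic q" "degree q = 1" "q dvd gamma_poly z" by auto
    obtain a b where ab: "q = [:b, a:]" "a \<noteq> 0" using q(2) by (rule degree1_coeffs)
    with q(1) have "q = [:b, 1:]" by simp
    then have "prime q" using prime_linear_poly by blast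
    have irr: "irreducible q" unfolding ab(1) using ab(2) by (rule irreducible_linear_field_poly)
    \<comment> \<open>Divisibility between normalized primes is equality.\<close>
    have "q = ?A" if "q dvd ?A" using that \<open>prime q\<close> prime_linear_poly primes_dvd_imp_eq by blast
    moreover have "q = ?B" if "q dvd ?B"
      using that \<open>prime q\<close> prime_linear_poly primes_dvd_imp_eq by blast
    ultimately show "q \<in> {?A, ?B}"
      using dvd_cases[OF irr q(3)] degree_factor[OF irr] q(2) m1 by auto
  qed (auto simp: factorization simp del: mult_pCons_left mult_pCons_right)
  then have card: "card {q. monic q \<and> degree q = 1 \<and> q dvd gamma_poly z} = 2"
    using rs by simp
  have degrees: "degree q = m" if "irreducible q" "q dvd gamma_poly z" "degree q \<noteq> 1" for q
  proof -
    have "degree q > 0" using that(1) by (rule irreducible_degree_field)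
    then have "\<not> q dvd [:a, 1:]" for a
      using that(3) dvd_imp_degree_le[of q "[:a, 1:]"] by auto
    then show ?thesis using dvd_cases degree_factor that by blast
  qed
  have quot: "gamma_poly z div [:1, z + 2, 1:] = ?G"
    unfolding factorization quadratic by (rule nonzero_mult_div_cancel_left) simp
  \<comment> \<open>All irreducible factors of the cofactor have degree \<open>m\<close>, while its
    own degree is \<open>p - 1\<close>.\<close>
  have "irreducible ?G \<longleftrightarrow> m = p - 1"
  proof
    assume "irreducible ?G"
    then show "m = p - 1" using degree_factor degree_G by force
  next
    assume m: "m = p - 1"
    have "\<not> is_unit ?G"
      using degree_G p_prime prime_gt_1_nat[of p] by (auto simp: is_unit_iff_degree G0)
    then obtain q where q: "prime q" "q dvd ?G" using G0 prime_divisor_exists by blast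
    then obtain k where k: "?G = q * k" by (elim dvdE)
    have irr: "irreducible q" using q(1) prime_imp_prime_elem prime_elem_imp_irreducible by blast
    \<comment> \<open>The factor \<open>q\<close> already has the full degree \<open>p - 1\<close>,
      so the complementary factor is a unit.\<close>
    have "degree k = 0"
      using degree_factor[OF irr q(2)] degree_G m G0 by (simp add: k degree_mult_eq)
    then have "is_unit k" using G0 k by (simp add: is_unit_iff_degree)
    then show "irreducible ?G" using irr by (simp add: k irreducible_mult_unit_right)
  qed
  then have "primitive_root_mod TYPE('p) R \<longleftrightarrow> irreducible (gamma_poly z div [:1, z + 2, 1:])"
    using r0 unfolding quot by (simp add: primitive_root_mod_iff_ord m_def p_card r_def)
  moreover have "[:1, z + 2, 1:] dvd gamma_poly z"
    unfolding factorization quadratic by (rule dvd_triv_left)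
  ultimately show ?thesis using size card degrees by blast
qed

end
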